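(* Let $\mathfrak{F}\equiv(X_i,\varphi_{ij})$ be a codiagram in $\mathfrak{Ban}$ indexed by a directed set $I$ satisfying the $\mathscr{E}$-property, with colimit $(X,\phi_i)$. Then $X$ is isometrically isomorphic to $\mathscr{L}(\mathfrak{F})$.
   Context: A directed set is a nonempty set $I$ with a reflexive and transitive relation $\le$ such that any two elements have a common upper bound. Write $i<j$ for the strict preorder induced by $\le$ ($i\le j$ and not $j\le i$). $(I,\le)$ has the $\mathscr{E}$-property if (1) for every $i\in I$ there is $j\in I$ with $i<j$; and (2) for every increasing chain $i_1<i_2<\cdots<i_n<\cdots$ in $I$ (indexed by $\mathbb{N}$) there is no $i\in I$ with $i_n\le i$ for all $n\in\mathbb{N}$. $\mathfrak{Ban}$ is the category of Banach spaces with linear isometries (not necessarily surjective) as morphisms. A codiagram indexed by $I$ is a family $(X_i,\varphi_{ij})$ of Banach spaces and linear isometries $\varphi_{ij}:X_i\to X_j$ ($i\le j$) with $\varphi_{ii}=\mathrm{id}$, $\varphi_{ik}=\varphi_{jk}\circ\varphi_{ij}$ for $i\le j\le k$. A cocone is a Banach space $Y$ with linear isometries $\psi_i:X_i\to Y$ such that $\psi_i=\psi_j\circ\varphi_{ij}$ for $i\le j$; it is the colimit if for every cocone $(Y',\rho_i)$ there is a unique linear isometry $\varphi:Y\to Y'$ with $\varphi\circ\psi_i=\rho_i$ for all $i$. A family $(x_i)_{i\in I}\in\prod_{i\in I}X_i$ is co-Cauchy if for every $\varepsilon>0$ there is $\ell\in I$ with $\|\varphi_{ij}(x_i)-x_j\|_{X_j}<\varepsilon$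 whenever $\ell\le i\le j$. $\mathscr{L}(\mathfrak{F})$ is the vector space of co-Cauchy families modulo $(x_i)\sim(y_i)$ iff $\lim_{i\in I}\|x_i-y_i\|_{X_i}=0$ (net limit), with norm $\|(x_i)\|_{\mathscr{L}}=\lim_{i\in I}\|x_i\|_{X_i}$ (net limit, which exists). *)

theory Defs
  imports
    "HOL-Analysis.Abstract_Metric_Spaces"
    "HOL-Algebra.Algebraic_Closure_Type"
begin

section \<open>Banach spaces and linear isometries\<close>

text \<open>
  Banach spaces are carrier-based, so that a family of them may have pairwise different
  underlying sets. The scalars are an arbitrary type \<open>'k :: real_normed_field\<close>; both \<open>real\<close> and
  \<open>complex\<close> are instances. The multiplicative fields that \<open>module\<close> inherits from \<open>ring\<close> carry no
  meaning and are never constrained.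
\<close>

record ('k, 'a) normed_module = "('k, 'a) module" +
  nrm :: "'a \<Rightarrow> real"

locale normed_vector_space =
  Module.module "ring_of_type_algebra :: 'k ring" V
  for V :: "('k :: real_normed_field, 'a) normed_module" (structure) +
  assumes nrm_eq_0_iff: "x \<in> carrier V \<Longrightarrow> nrm V x = 0 \<longleftrightarrow> x = \<zero>"
    and nrm_nonneg: "x \<in> carrier V \<Longrightarrow> 0 \<le> nrm V x"
    and nrm_triangle:
      "\<lbrakk>x \<in> carrier V; y \<in> carrier V\<rbrakk> \<Longrightarrow> nrm V (x \<oplus> y) \<le> nrm V x + nrm V y"
    and nrm_smult: "x \<in> carrier V \<Longrightarrow> nrm V (a \<odot> x) = norm a * nrm V x"

text \<open>
  \<open>Metric_space\<close> requires nonnegativity and symmetry also outside the carrier; hence the guard.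
\<close>

definition nrm_dist :: "('k, 'a) normed_module \<Rightarrow> 'a \<Rightarrow> 'a \<Rightarrow> real" where
  "nrm_dist V x y =
     (if x \<in> carrier V \<and> y \<in> carrier V then nrm V (x \<ominus>\<^bsub>V\<^esub> y) else 0)"

definition banach_space :: "('k :: real_normed_field, 'a) normed_module \<Rightarrow> bool" where
  "banach_space V \<longleftrightarrow>
     normed_vector_space V \<and> Metric_space.mcomplete (carrier V) (nrm_dist V)"

definition linear_isometry ::
  "('k, 'a) normed_module \<Rightarrow> ('k, 'b) normed_module \<Rightarrow> ('a \<Rightarrow> 'b) \<Rightarrow> bool" where
  "linear_isometry V W f \<longleftrightarrow>
     f \<in> carrier V \<rightarrow> carrier W \<and>
     (\<forall>x\<in>carrier V. \<forall>y\<in>carrier V. f (x \<oplus>\<^bsub>V\<^esub> y) = f x \<oplus>\<^bsub>W\<^esub> f y) \<and>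
     (\<forall>a. \<forall>x\<in>carrier V. f (a \<odot>\<^bsub>V\<^esub> x) = a \<odot>\<^bsub>W\<^esub> f x) \<and>
     (\<forall>x\<in>carrier V. nrm W (f x) = nrm V x)"

definition isometrically_isomorphic ::
  "('k, 'a) normed_module \<Rightarrow> ('k, 'b) normed_module \<Rightarrow> bool" where
  "isometrically_isomorphic V W \<longleftrightarrow>
     (\<exists>f. linear_isometry V W f \<and> bij_betw f (carrier V) (carrier W))"


section \<open>Directed sets\<close>

definition directed_set :: "'i set \<Rightarrow> ('i \<Rightarrow> 'i \<Rightarrow> bool) \<Rightarrow> bool" where
  "directed_set I leq \<longleftrightarrow>
     I \<noteq> {} \<and> reflp_on I leq \<and> transp_on I leq \<and>
     (\<forall>i\<in>I. \<forall>j\<in>I. \<exists>k\<in>I. leq i k \<and> leq j k)"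

definition strict_leq :: "('i \<Rightarrow> 'i \<Rightarrow> bool) \<Rightarrow> 'i \<Rightarrow> 'i \<Rightarrow> bool" where
  "strict_leq leq i j \<longleftrightarrow> leq i j \<and> \<not> leq j i"

definition E_property :: "'i set \<Rightarrow> ('i \<Rightarrow> 'i \<Rightarrow> bool) \<Rightarrow> bool" where
  "E_property I leq \<longleftrightarrow>
     (\<forall>i\<in>I. \<exists>j\<in>I. strict_leq leq i j) \<and>
     (\<forall>c :: nat \<Rightarrow> 'i. (\<forall>n. c n \<in> I) \<and> (\<forall>n. strict_leq leq (c n) (c (Suc n)))
        \<longrightarrow> \<not> (\<exists>i\<in>I. \<forall>n. leq (c n) i))"

text \<open>The filter of tails, so that \<open>(f \<longlongrightarrow> l) (tails I leq)\<close> is convergence of the net \<open>f\<close> on \<open>I\<close>.\<close>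

definition tails :: "'i set \<Rightarrow> ('i \<Rightarrow> 'i \<Rightarrow> bool) \<Rightarrow> 'i filter" where
  "tails I leq = (INF l\<in>I. principal {i \<in> I. leq l i})"


section \<open>Codiagrams and colimits\<close>

definition codiagram ::
  "'i set \<Rightarrow> ('i \<Rightarrow> 'i \<Rightarrow> bool) \<Rightarrow> ('i \<Rightarrow> ('k :: real_normed_field, 'a) normed_module)
    \<Rightarrow> ('i \<Rightarrow> 'i \<Rightarrow> 'a \<Rightarrow> 'a) \<Rightarrow> bool" where
  "codiagram I leq F \<phi> \<longleftrightarrow>
     (\<forall>i\<in>I. banach_space (F i)) \<and>
     (\<forall>i\<in>I. \<forall>j\<in>I. leq i j \<longrightarrow> linear_isometry (F i) (F j) (\<phi> i j)) \<and>
     (\<forall>i\<in>I. \<forall>x\<in>carrier (F i). \<phi> i i x = x) \<and>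
     (\<forall>i\<in>I. \<forall>j\<in>I. \<forall>k\<in>I. leq i j \<and> leq j k \<longrightarrow>
        (\<forall>x\<in>carrier (F i). \<phi> i k x = \<phi> j k (\<phi> i j x)))"

definition cocone ::
  "'i set \<Rightarrow> ('i \<Rightarrow> 'i \<Rightarrow> bool) \<Rightarrow> ('i \<Rightarrow> ('k :: real_normed_field, 'a) normed_module)
    \<Rightarrow> ('i \<Rightarrow> 'i \<Rightarrow> 'a \<Rightarrow> 'a) \<Rightarrow> ('k, 'b) normed_module \<Rightarrow> ('i \<Rightarrow> 'a \<Rightarrow> 'b) \<Rightarrow> bool" where
  "cocone I leq F \<phi> Y \<psi> \<longleftrightarrow>
     banach_space Y \<and>
     (\<forall>i\<in>I. linear_isometry (F i) Y (\<psi> i)) \<and>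
     (\<forall>i\<in>I. \<forall>j\<in>I. leq i j \<longrightarrow> (\<forall>x\<in>carrier (F i). \<psi> i x = \<psi> j (\<phi> i j x)))"

text \<open>
  HOL cannot quantify over all types inside a formula, so the competing cocones range over all
  Banach spaces whose carrier is a subset of the type \<open>'b\<close> in which \<open>Y\<close> lives. A colimit in the
  category of all Banach spaces in particular satisfies this condition. Conversely, comparing
  \<open>Y\<close> with the closure of the union of the images of the \<open>\<psi> i\<close>, which is a Banach space in the
  same type, shows that this union is dense in \<open>Y\<close>, whence the universal property for
  Banach spaces in any type. Restricting to \<open>extensional\<close> functions makes uniqueness mean
  uniqueness on the carrier.
\<close>

definition is_colimit ::
  "'i set \<Rightarrow> ('i \<Rightarrow> 'i \<Rightarrow> bool) \<Rightarrow> ('i \<Rightarrow> ('k :: real_normed_field, 'a) normed_module)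
    \<Rightarrow> ('i \<Rightarrow> 'i \<Rightarrow> 'a \<Rightarrow> 'a) \<Rightarrow> ('k, 'b) normed_module \<Rightarrow> ('i \<Rightarrow> 'a \<Rightarrow> 'b) \<Rightarrow> bool" where
  "is_colimit I leq F \<phi> Y \<psi> \<longleftrightarrow>
     cocone I leq F \<phi> Y \<psi> \<and>
     (\<forall>(Z :: ('k, 'b) normed_module) \<rho>. cocone I leq F \<phi> Z \<rho> \<longrightarrow>
        (\<exists>!f. f \<in> extensional (carrier Y) \<and> linear_isometry Y Z f \<and>
              (\<forall>i\<in>I. \<forall>x\<in>carrier (F i). f (\<psi> i x) = \<rho> i x)))"


section \<open>The space of co-Cauchy families\<close>

definition co_Cauchy ::
  "'i set \<Rightarrow> ('i \<Rightarrow> 'i \<Rightarrow> bool) \<Rightarrow> ('i \<Rightarrow> ('k, 'a) normed_module)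
    \<Rightarrow> ('i \<Rightarrow> 'i \<Rightarrow> 'a \<Rightarrow> 'a) \<Rightarrow> ('i \<Rightarrow> 'a) set" where
  "co_Cauchy I leq F \<phi> =
     {x \<in> (\<Pi>\<^sub>E i\<in>I. carrier (F i)).
        \<forall>\<epsilon>>0. \<exists>l\<in>I. \<forall>i\<in>I. \<forall>j\<in>I. leq l i \<and> leq i j \<longrightarrow>
          nrm (F j) (\<phi> i j (x i) \<ominus>\<^bsub>F j\<^esub> x j) < \<epsilon>}"

definition co_Cauchy_rel ::
  "'i set \<Rightarrow> ('i \<Rightarrow> 'i \<Rightarrow> bool) \<Rightarrow> ('i \<Rightarrow> ('k, 'a) normed_module)
    \<Rightarrow> ('i \<Rightarrow> 'i \<Rightarrow> 'a \<Rightarrow> 'a) \<Rightarrow> (('i \<Rightarrow> 'a) \<times> ('i \<Rightarrow> 'a)) set" where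
  "co_Cauchy_rel I leq F \<phi> =
     {(x, y). x \<in> co_Cauchy I leq F \<phi> \<and> y \<in> co_Cauchy I leq F \<phi> \<and>
        ((\<lambda>i. nrm (F i) (x i \<ominus>\<^bsub>F i\<^esub> y i)) \<longlongrightarrow> 0) (tails I leq)}"

text \<open>
  The operations on equivalence classes are those induced by the pointwise operations on
  representatives; for a codiagram they, and the norm, do not depend on the representatives.
\<close>

definition co_Cauchy_space ::
  "'i set \<Rightarrow> ('i \<Rightarrow> 'i \<Rightarrow> bool) \<Rightarrow> ('i \<Rightarrow> ('k, 'a) normed_module)
    \<Rightarrow> ('i \<Rightarrow> 'i \<Rightarrow> 'a \<Rightarrow> 'a) \<Rightarrow> ('k, ('i \<Rightarrow> 'a) set) normed_module" where
  "co_Cauchy_space I leq F \<phi> =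
     (let R = co_Cauchy_rel I leq F \<phi> in
      \<lparr> carrier = co_Cauchy I leq F \<phi> // R,
        monoid.mult = undefined,
        one = undefined,
        ring.zero = R `` {\<lambda>i\<in>I. \<zero>\<^bsub>F i\<^esub>},
        add = (\<lambda>A B. \<Union>x\<in>A. \<Union>y\<in>B. R `` {\<lambda>i\<in>I. x i \<oplus>\<^bsub>F i\<^esub> y i}),
        module.smult = (\<lambda>a A. \<Union>x\<in>A. R `` {\<lambda>i\<in>I. a \<odot>\<^bsub>F i\<^esub> x i}),
        nrm = (\<lambda>A. THE r. \<forall>x\<in>A. ((\<lambda>i. nrm (F i) (x i)) \<longlongrightarrow> r) (tails I leq)) \<rparr>)"

end

theory Submission
  imports Defs
begin

text \<open>
  Everything is measured in \<open>Y\<close>. A family \<open>x\<close> with \<open>x i\<close> in \<open>F i\<close> gives a net \<open>\<psi> i (x i)\<close> in \<open>Y\<close>,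
  and because \<open>\<psi> j\<close> is isometric and \<open>\<psi> j (\<phi> i j (x i)) = \<psi> i (x i)\<close>, the number
  \<open>nrm (F j) (\<phi> i j (x i) \<ominus> x j)\<close> is the distance of the net's terms at \<open>i\<close> and \<open>j\<close>. So the
  co-Cauchy families are those whose net is Cauchy, hence convergent (\<open>represents_co_Cauchy\<close>,
  \<open>co_Cauchy_represents\<close>), and two of them are equivalent exactly when their nets have the same
  limit (\<open>represents_rel_iff\<close>). The limit therefore embeds the space of co-Cauchy families in \<open>Y\<close>,
  linearly and isometrically, for any cocone \<open>Y\<close>.

  Its range is the closure of the union of the images of the \<open>\<psi> i\<close>. To reach a point \<open>y\<close> of that
  closure, choose \<open>x i\<close> so that \<open>\<psi> i (x i)\<close> is, up to a factor 2, as close to \<open>y\<close> as the image of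
  \<open>\<psi> i\<close> permits (\<open>union_closure_represented\<close>). These images grow with \<open>i\<close>, so the distances to
  them tend to zero along \<open>I\<close>, and the chosen family converges to \<open>y\<close>. No errors tending to
  zero along \<open>I\<close> need be prescribed; an arbitrary directed set may admit no positive ones.

  It remains that in a colimit the closure is all of \<open>Y\<close> (\<open>colimit_union_dense\<close>): the closure is
  itself a cocone, and the map from \<open>Y\<close> to it given by the universal property must be the identity.
\<close>

section \<open>Limits in normed vector spaces\<close>

context normed_vector_space
begin

lemma scalar_carrier [simp]: "a \<in> carrier (ring_of_type_algebra :: 'k ring)"
  by (simp add: ring_of_type_algebra_def)

lemma scalar_add [simp]: "a \<oplus>\<^bsub>ring_of_type_algebra\<^esub> b = a + (b :: 'k)"
  by (simp add: ring_of_type_algebra_def)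

lemma scalar_one [simp]: "\<one>\<^bsub>ring_of_type_algebra\<^esub> = (1 :: 'k)"
  by (simp add: ring_of_type_algebra_def)

lemma smult_in_carrier [simp, intro]: "x \<in> carrier V \<Longrightarrow> (a :: 'k) \<odot> x \<in> carrier V"
  by (simp add: smult_closed)

lemma smult_zero_left: "x \<in> carrier V \<Longrightarrow> (0 :: 'k) \<odot> x = \<zero>"
  using nrm_smult[of x 0] nrm_eq_0_iff[of "0 \<odot> x"] by simp

lemma uminus_eq_smult: "x \<in> carrier V \<Longrightarrow> \<ominus> x = (-1 :: 'k) \<odot> x"
proof -
  assume x: "x \<in> carrier V"
  have "(-1 :: 'k) \<odot> x \<oplus> x = ((-1) \<oplus>\<^bsub>ring_of_type_algebra\<^esub> (1 :: 'k)) \<odot> x"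
    using smult_l_distr[of "-1 :: 'k" 1 x] smult_one[OF x] x by simp
  also have "\<dots> = \<zero>"
    using x by (simp add: smult_zero_left)
  finally show ?thesis
    using x by (intro M.minus_equality) auto
qed

lemma nrm_uminus: "x \<in> carrier V \<Longrightarrow> nrm V (\<ominus> x) = nrm V x"
  by (simp add: uminus_eq_smult nrm_smult)

lemma nrm_zero: "nrm V \<zero> = 0"
  by (simp add: nrm_eq_0_iff)

lemma minus_add_cancel: "\<lbrakk>x \<in> carrier V; y \<in> carrier V\<rbrakk> \<Longrightarrow> (x \<ominus> y) \<oplus> y = x"
  by (simp add: M.minus_eq M.a_assoc M.l_neg)

lemma nrm_minus_eq_0_iff:
  assumes "x \<in> carrier V" "y \<in> carrier V"
  shows "nrm V (x \<ominus> y) = 0 \<longleftrightarrow> x = y"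
proof
  assume "nrm V (x \<ominus> y) = 0"
  then show "x = y"
    using assms minus_add_cancel[OF assms] by (simp add: nrm_eq_0_iff)
next
  assume "x = y"
  then show "nrm V (x \<ominus> y) = 0"
    using assms by (simp add: M.minus_eq M.r_neg nrm_zero)
qed

lemma nrm_minus_commute:
  assumes "x \<in> carrier V" "y \<in> carrier V"
  shows "nrm V (x \<ominus> y) = nrm V (y \<ominus> x)"
proof -
  have "x \<ominus> y = \<ominus> (y \<ominus> x)"
    using assms by (simp add: M.minus_eq M.minus_add M.a_comm)
  then show ?thesis
    using assms nrm_uminus[of "y \<ominus> x"] by simp
qed

lemma minus_add_minus:
  assumes "x \<in> carrier V" "y \<in> carrier V" "z \<in> carrier V"
  shows "(x \<ominus> y) \<oplus> (y \<ominus> z) = x \<ominus> z"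
  using assms by (simp add: M.minus_eq M.a_assoc M.r_neg1)

lemma nrm_minus_triangle:
  assumes "x \<in> carrier V" "y \<in> carrier V" "z \<in> carrier V"
  shows "nrm V (x \<ominus> z) \<le> nrm V (x \<ominus> y) + nrm V (y \<ominus> z)"
  using nrm_triangle[of "x \<ominus> y" "y \<ominus> z"] minus_add_minus[OF assms] assms by simp

lemma nrm_diff_le:
  assumes "x \<in> carrier V" "y \<in> carrier V"
  shows "\<bar>nrm V x - nrm V y\<bar> \<le> nrm V (x \<ominus> y)"
proof -
  have *: "nrm V u \<le> nrm V (u \<ominus> v) + nrm V v"
    if "u \<in> carrier V" "v \<in> carrier V" for u v
    using nrm_triangle[of "u \<ominus> v" v] that by (simp add: minus_add_cancel)
  show ?thesis
    using *[OF assms] *[OF assms(2,1)] nrm_minus_commute[OF assms] by linarith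
qed

lemma add_minus_add:
  assumes "x \<in> carrier V" "y \<in> carrier V" "u \<in> carrier V" "v \<in> carrier V"
  shows "(x \<oplus> y) \<ominus> (u \<oplus> v) = (x \<ominus> u) \<oplus> (y \<ominus> v)"
  using assms by (simp add: M.minus_eq M.minus_add M.a_ac)

lemma smult_minus:
  assumes "x \<in> carrier V" "y \<in> carrier V"
  shows "(a :: 'k) \<odot> x \<ominus> a \<odot> y = a \<odot> (x \<ominus> y)"
  using assms by (simp add: M.minus_eq smult_r_distr smult_r_minus)

lemma Metric_space_nrm_dist: "Metric_space (carrier V) (nrm_dist V)"
proof
  show "nrm_dist V x y = nrm_dist V y x" for x y
    by (simp add: nrm_dist_def nrm_minus_commute)
qed (auto simp: nrm_dist_def nrm_nonneg nrm_minus_eq_0_iff nrm_minus_triangle)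

text \<open>
  For the metric \<open>nrm_dist V\<close> this is \<open>limitin\<close>, written with the norm so that linear operations can
  be applied to it.
\<close>

definition nrm_lim :: "('i \<Rightarrow> 'a) \<Rightarrow> 'a \<Rightarrow> 'i filter \<Rightarrow> bool" where
  "nrm_lim f l G \<longleftrightarrow> l \<in> carrier V \<and> eventually (\<lambda>i. f i \<in> carrier V) G \<and>
     ((\<lambda>i. nrm V (f i \<ominus> l)) \<longlongrightarrow> 0) G"

lemma nrm_limI:
  assumes "l \<in> carrier V" "eventually (\<lambda>i. f i \<in> carrier V) G"
    and "eventually (\<lambda>i. nrm V (f i \<ominus> l) \<le> g i) G" "(g \<longlongrightarrow> 0) G"
  shows "nrm_lim f l G"
  unfolding nrm_lim_def
proof (intro conjI assms tendsto_0_le[OF assms(4), where K = 1])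
  show "\<forall>\<^sub>F i in G. norm (nrm V (f i \<ominus> l)) \<le> norm (g i) * 1"
    using assms(2,3) by eventually_elim (use assms(1) nrm_nonneg in force)
qed

lemma nrm_lim_add:
  assumes "nrm_lim f l G" "nrm_lim g m G"
  shows "nrm_lim (\<lambda>i. f i \<oplus> g i) (l \<oplus> m) G"
proof (rule nrm_limI)
  have ev: "eventually (\<lambda>i. f i \<in> carrier V \<and> g i \<in> carrier V) G"
    using assms by (auto simp: nrm_lim_def eventually_conj_iff)
  then show "eventually (\<lambda>i. f i \<oplus> g i \<in> carrier V) G"
    by eventually_elim simp
  show "eventually (\<lambda>i. nrm V (f i \<oplus> g i \<ominus> (l \<oplus> m)) \<le> nrm V (f i \<ominus> l) + nrm V (g i \<ominus> m)) G"
    using ev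
    by eventually_elim (use assms in \<open>simp add: nrm_lim_def add_minus_add nrm_triangle\<close>)
  show "((\<lambda>i. nrm V (f i \<ominus> l) + nrm V (g i \<ominus> m)) \<longlongrightarrow> 0) G"
    using assms by (auto simp: nrm_lim_def intro: tendsto_add_zero)
qed (use assms in \<open>auto simp: nrm_lim_def\<close>)

lemma nrm_lim_smult:
  assumes "nrm_lim f l G"
  shows "nrm_lim (\<lambda>i. (a :: 'k) \<odot> f i) (a \<odot> l) G"
proof (rule nrm_limI)
  have ev: "eventually (\<lambda>i. f i \<in> carrier V) G"
    using assms by (auto simp: nrm_lim_def)
  then show "eventually (\<lambda>i. a \<odot> f i \<in> carrier V) G"
    by eventually_elim simp
  show "eventually (\<lambda>i. nrm V (a \<odot> f i \<ominus> a \<odot> l) \<le> norm a * nrm V (f i \<ominus> l)) G"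
    using ev by eventually_elim (use assms in \<open>simp add: nrm_lim_def smult_minus nrm_smult\<close>)
  show "((\<lambda>i. norm a * nrm V (f i \<ominus> l)) \<longlongrightarrow> 0) G"
    using assms by (auto simp: nrm_lim_def intro: tendsto_mult_right_zero)
qed (use assms in \<open>auto simp: nrm_lim_def\<close>)

lemma nrm_lim_cong:
  assumes "nrm_lim f l G" "eventually (\<lambda>i. f i = g i) G"
  shows "nrm_lim g l G"
proof (rule nrm_limI)
  show "eventually (\<lambda>i. g i \<in> carrier V) G"
    using assms unfolding nrm_lim_def by (auto elim: eventually_elim2)
  show "eventually (\<lambda>i. nrm V (g i \<ominus> l) \<le> nrm V (f i \<ominus> l)) G"
    using assms(2) by eventually_elim simp
qed (use assms in \<open>auto simp: nrm_lim_def\<close>)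

lemma nrm_lim_minus:
  assumes "nrm_lim f l G" "nrm_lim g m G"
  shows "nrm_lim (\<lambda>i. f i \<ominus> g i) (l \<ominus> m) G"
proof (rule nrm_lim_cong)
  have "nrm_lim (\<lambda>i. f i \<oplus> (-1 :: 'k) \<odot> g i) (l \<oplus> (-1 :: 'k) \<odot> m) G"
    using assms by (intro nrm_lim_add nrm_lim_smult)
  then show "nrm_lim (\<lambda>i. f i \<oplus> (-1 :: 'k) \<odot> g i) (l \<ominus> m) G"
    using assms by (simp add: nrm_lim_def M.minus_eq uminus_eq_smult)
  have "eventually (\<lambda>i. g i \<in> carrier V) G"
    using assms by (simp add: nrm_lim_def)
  then show "eventually (\<lambda>i. f i \<oplus> (-1 :: 'k) \<odot> g i = f i \<ominus> g i) G"
    by eventually_elim (simp add: M.minus_eq uminus_eq_smult)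
qed

lemma nrm_lim_nrm:
  assumes "nrm_lim f l G"
  shows "((\<lambda>i. nrm V (f i)) \<longlongrightarrow> nrm V l) G"
proof (rule LIM_zero_cancel, rule tendsto_0_le[where K = 1])
  show "((\<lambda>i. nrm V (f i \<ominus> l)) \<longlongrightarrow> 0) G"
    using assms by (simp add: nrm_lim_def)
  have "eventually (\<lambda>i. f i \<in> carrier V) G"
    using assms by (auto simp: nrm_lim_def)
  then show "\<forall>\<^sub>F i in G. norm (nrm V (f i) - nrm V l) \<le> norm (nrm V (f i \<ominus> l)) * 1"
    by eventually_elim
      (use assms in \<open>simp add: nrm_lim_def nrm_nonneg nrm_diff_le\<close>)
qed

lemma nrm_lim_unique:
  assumes "nrm_lim f l G" "nrm_lim f m G" "G \<noteq> bot"
  shows "l = m"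
proof -
  have "((\<lambda>i. nrm V (f i \<ominus> f i)) \<longlongrightarrow> nrm V (l \<ominus> m)) G"
    using assms by (intro nrm_lim_nrm nrm_lim_minus)
  moreover have "eventually (\<lambda>i. nrm V (f i \<ominus> f i) = 0) G"
    using assms unfolding nrm_lim_def by (auto elim!: eventually_mono simp: nrm_minus_eq_0_iff)
  ultimately have "nrm V (l \<ominus> m) = 0"
    using tendsto_unique[OF assms(3) _ tendsto_eventually] by blast
  then show ?thesis
    using assms by (simp add: nrm_lim_def nrm_minus_eq_0_iff)
qed

lemma mcomplete_nrm_dist_iff:
  "Metric_space.mcomplete (carrier V) (nrm_dist V) \<longleftrightarrow>
     (\<forall>s. range s \<subseteq> carrier V \<longrightarrow>
        (\<forall>e>0. \<exists>N. \<forall>m\<ge>N. \<forall>n\<ge>N. nrm V (s m \<ominus> s n) < e) \<longrightarrow>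
        (\<exists>l. nrm_lim s l sequentially))"
proof -
  interpret Metric_space "carrier V" "nrm_dist V"
    by (rule Metric_space_nrm_dist)
  have cau: "MCauchy s \<longleftrightarrow> range s \<subseteq> carrier V \<and>
      (\<forall>e>0. \<exists>N. \<forall>m\<ge>N. \<forall>n\<ge>N. nrm V (s m \<ominus> s n) < e)" for s
  proof (cases "range s \<subseteq> carrier V")
    case True
    then have "s n \<in> carrier V" for n
      by blast
    then have "nrm_dist V (s m) (s n) = nrm V (s m \<ominus> s n)" for m n
      by (simp add: nrm_dist_def)
    then show ?thesis
      using True by (simp add: MCauchy_def)
  qed (simp add: MCauchy_def)
  have lim: "limitin mtopology s l sequentially \<longleftrightarrow> nrm_lim s l sequentially"
    if "range s \<subseteq> carrier V" for s l
  proof (cases "l \<in> carrier V")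
    case True
    have "s n \<in> carrier V" for n
      using that by blast
    then have "nrm_dist V (s n) l = nrm V (s n \<ominus> l)" for n
      using True by (simp add: nrm_dist_def)
    then show ?thesis
      by (simp add: limitin_metric_dist_null nrm_lim_def)
  qed (simp add: nrm_lim_def limitin_metric_dist_null)
  have "(MCauchy s \<longrightarrow> (\<exists>l. limitin mtopology s l sequentially)) \<longleftrightarrow>
      (range s \<subseteq> carrier V \<longrightarrow>
        (\<forall>e>0. \<exists>N. \<forall>m\<ge>N. \<forall>n\<ge>N. nrm V (s m \<ominus> s n) < e) \<longrightarrow>
        (\<exists>l. nrm_lim s l sequentially))" for s
  proof (cases "range s \<subseteq> carrier V")
    case True
    show ?thesis
      by (simp only: cau lim[OF True] True simp_thms)
  qed (simp only: cau simp_thms)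
  then show ?thesis
    by (simp only: mcomplete_def)
qed

lemma normed_vector_space_subspace:
  assumes sub: "D \<subseteq> carrier V" and zero: "\<zero> \<in> D"
    and add: "\<And>x y. \<lbrakk>x \<in> D; y \<in> D\<rbrakk> \<Longrightarrow> x \<oplus> y \<in> D"
    and smult: "\<And>a x. x \<in> D \<Longrightarrow> (a :: 'k) \<odot> x \<in> D"
  shows "normed_vector_space (V\<lparr>carrier := D\<rparr>)"
proof -
  have "submodule D (ring_of_type_algebra :: 'k ring) V"
    using assms by (intro submoduleI) (auto simp: uminus_eq_smult subset_iff)
  then interpret D: Module.module "ring_of_type_algebra :: 'k ring" "V\<lparr>carrier := D\<rparr>"
    by (rule submodule.submodule_is_module) unfold_locales
  show ?thesis
    by unfold_locales
      (use sub in \<open>auto simp: nrm_eq_0_iff nrm_nonneg nrm_triangle nrm_smult subset_iff\<close>)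
qed

end

lemma linear_isometryD:
  assumes "linear_isometry V W f"
  shows "x \<in> carrier V \<Longrightarrow> f x \<in> carrier W"
    and "\<lbrakk>x \<in> carrier V; y \<in> carrier V\<rbrakk> \<Longrightarrow> f (x \<oplus>\<^bsub>V\<^esub> y) = f x \<oplus>\<^bsub>W\<^esub> f y"
    and "x \<in> carrier V \<Longrightarrow> f (a \<odot>\<^bsub>V\<^esub> x) = a \<odot>\<^bsub>W\<^esub> f x"
    and "x \<in> carrier V \<Longrightarrow> nrm W (f x) = nrm V x"
  using assms by (auto simp: linear_isometry_def)

lemma linear_isometry_minus:
  assumes "normed_vector_space V" "normed_vector_space W" "linear_isometry V W f"
    and "x \<in> carrier V" "y \<in> carrier V"
  shows "f (x \<ominus>\<^bsub>V\<^esub> y) = f x \<ominus>\<^bsub>W\<^esub> f y"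
proof -
  interpret V: normed_vector_space V by fact
  interpret W: normed_vector_space W by fact
  note f = linear_isometryD[OF assms(3)]
  show ?thesis
    using assms(4,5)
    by (simp add: V.M.minus_eq W.M.minus_eq V.uminus_eq_smult W.uminus_eq_smult f)
qed

lemma linear_isometry_nrm_minus:
  assumes "normed_vector_space V" "normed_vector_space W" "linear_isometry V W f"
    and "x \<in> carrier V" "y \<in> carrier V"
  shows "nrm W (f x \<ominus>\<^bsub>W\<^esub> f y) = nrm V (x \<ominus>\<^bsub>V\<^esub> y)"
proof -
  interpret V: normed_vector_space V by fact
  show ?thesis
    using assms(4,5) linear_isometryD(4)[OF assms(3), of "x \<ominus>\<^bsub>V\<^esub> y"]
    by (simp add: linear_isometry_minus[OF assms])
qed

text \<open>
  Subtraction in \<open>V\<lparr>carrier := D\<rparr>\<close> is defined from inverses sought in \<open>D\<close>, so it agrees with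
  subtraction in \<open>V\<close> only because the inclusion is linear.
\<close>

lemma (in normed_vector_space) banach_space_closed_subspace:
  assumes V: "banach_space V"
    and sub: "D \<subseteq> carrier V" and zero: "\<zero> \<in> D"
    and add: "\<And>x y. \<lbrakk>x \<in> D; y \<in> D\<rbrakk> \<Longrightarrow> x \<oplus> y \<in> D"
    and smult: "\<And>a x. x \<in> D \<Longrightarrow> (a :: 'k) \<odot> x \<in> D"
    and closed: "\<And>s l. \<lbrakk>range s \<subseteq> D; nrm_lim s l sequentially\<rbrakk> \<Longrightarrow> l \<in> D"
  shows "banach_space (V\<lparr>carrier := D\<rparr>)"
proof -
  let ?W = "V\<lparr>carrier := D\<rparr>"
  interpret W: normed_vector_space ?W
    using sub zero add smult by (rule normed_vector_space_subspace)
  have inclusion: "linear_isometry ?W V id"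
    using sub by (auto simp: linear_isometry_def)
  have minus: "x \<ominus>\<^bsub>?W\<^esub> y = x \<ominus> y" if "x \<in> D" "y \<in> D" for x y
    using linear_isometry_minus[OF W.normed_vector_space_axioms normed_vector_space_axioms inclusion,
        of x y] that
    by simp
  have "\<exists>l. W.nrm_lim s l sequentially"
    if s: "range s \<subseteq> carrier ?W" and cau: "\<forall>e>0. \<exists>N. \<forall>m\<ge>N. \<forall>n\<ge>N. nrm ?W (s m \<ominus>\<^bsub>?W\<^esub> s n) < e" for s
  proof -
    have sD: "s n \<in> D" for n
      using s by auto
    have "\<forall>e>0. \<exists>N. \<forall>m\<ge>N. \<forall>n\<ge>N. nrm V (s m \<ominus> s n) < e"
      using cau by (simp add: minus sD)
    moreover have "range s \<subseteq> carrier V"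
      using sD sub by blast
    ultimately obtain l where l: "nrm_lim s l sequentially"
      using V unfolding banach_space_def mcomplete_nrm_dist_iff by blast
    then have "l \<in> D"
      using closed[of s l] sD by blast
    then have "W.nrm_lim s l sequentially"
      using l by (simp add: nrm_lim_def W.nrm_lim_def minus sD)
    then show ?thesis ..
  qed
  then show ?thesis
    unfolding banach_space_def W.mcomplete_nrm_dist_iff
    using W.normed_vector_space_axioms by blast
qed


section \<open>Families representing points of a cocone\<close>

lemma eventually_tails:
  assumes "directed_set I leq"
  shows "eventually P (tails I leq) \<longleftrightarrow> (\<exists>l\<in>I. \<forall>i\<in>I. leq l i \<longrightarrow> P i)"
proof -
  have ne: "I \<noteq> {}" and tr: "transp_on I leq"
    and up: "\<forall>i\<in>I. \<forall>j\<in>I. \<exists>k\<in>I. leq i k \<and> leq j k"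
    using assms by (auto simp: directed_set_def)
  have "eventually P (tails I leq) \<longleftrightarrow> (\<exists>l\<in>I. eventually P (principal {i \<in> I. leq l i}))"
    unfolding tails_def
  proof (rule eventually_INF_base[OF ne])
    fix a b assume ab: "a \<in> I" "b \<in> I"
    with up obtain k where k: "k \<in> I" "leq a k" "leq b k"
      by blast
    have "{i \<in> I. leq k i} \<subseteq> {i \<in> I. leq a i} \<inter> {i \<in> I. leq b i}"
      using tr k ab by (auto elim: transp_onD)
    then show "\<exists>x\<in>I. principal {i \<in> I. leq x i}
        \<le> inf (principal {i \<in> I. leq a i}) (principal {i \<in> I. leq b i})"
      using k by (auto intro!: bexI[of _ k])
  qed
  then show ?thesis
    by (auto simp: eventually_principal)
qed

locale directed_cocone =
  fixes I :: "'i set" and leq :: "'i \<Rightarrow> 'i \<Rightarrow> bool"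
    and F :: "'i \<Rightarrow> ('k :: real_normed_field, 'a) normed_module"
    and \<phi> :: "'i \<Rightarrow> 'i \<Rightarrow> 'a \<Rightarrow> 'a"
    and Y :: "('k, 'b) normed_module"
    and \<psi> :: "'i \<Rightarrow> 'a \<Rightarrow> 'b"
  assumes directed: "directed_set I leq"
    and codiagram: "codiagram I leq F \<phi>"
    and cocone: "cocone I leq F \<phi> Y \<psi>"
begin

sublocale Y: normed_vector_space Y
  using cocone by (simp add: cocone_def banach_space_def)

lemma banach_Y: "banach_space Y"
  using cocone by (simp add: cocone_def)

lemma banach_F: "i \<in> I \<Longrightarrow> banach_space (F i)"
  using codiagram by (simp add: codiagram_def)

lemma normed_F: "i \<in> I \<Longrightarrow> normed_vector_space (F i)"
  using banach_F by (simp add: banach_space_def)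

lemma isometry_\<phi>: "\<lbrakk>i \<in> I; j \<in> I; leq i j\<rbrakk> \<Longrightarrow> linear_isometry (F i) (F j) (\<phi> i j)"
  using codiagram by (simp add: codiagram_def)

lemma isometry_\<psi>: "i \<in> I \<Longrightarrow> linear_isometry (F i) Y (\<psi> i)"
  using cocone by (simp add: cocone_def)

lemma \<phi>_in: "\<lbrakk>i \<in> I; j \<in> I; leq i j; x \<in> carrier (F i)\<rbrakk> \<Longrightarrow> \<phi> i j x \<in> carrier (F j)"
  using isometry_\<phi> by (rule linear_isometryD(1))

lemma \<psi>_in: "\<lbrakk>i \<in> I; x \<in> carrier (F i)\<rbrakk> \<Longrightarrow> \<psi> i x \<in> carrier Y"
  using isometry_\<psi> by (rule linear_isometryD(1))

lemma \<psi>_\<phi>: "\<lbrakk>i \<in> I; j \<in> I; leq i j; x \<in> carrier (F i)\<rbrakk> \<Longrightarrow> \<psi> j (\<phi> i j x) = \<psi> i x"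
  using cocone by (simp add: cocone_def)

lemma upper_bound: "\<lbrakk>i \<in> I; j \<in> I\<rbrakk> \<Longrightarrow> \<exists>k\<in>I. leq i k \<and> leq j k"
  using directed by (simp add: directed_set_def)

lemma leq_refl: "i \<in> I \<Longrightarrow> leq i i"
  using directed by (auto simp: directed_set_def reflp_on_def)

lemma leq_trans: "\<lbrakk>i \<in> I; j \<in> I; k \<in> I; leq i j; leq j k\<rbrakk> \<Longrightarrow> leq i k"
  using directed transp_onD[of I leq i j k] by (simp add: directed_set_def)

lemma nrm_\<psi>_minus:
  assumes "i \<in> I" "x \<in> carrier (F i)" "y \<in> carrier (F i)"
  shows "nrm Y (\<psi> i x \<ominus>\<^bsub>Y\<^esub> \<psi> i y) = nrm (F i) (x \<ominus>\<^bsub>F i\<^esub> y)"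
  using assms linear_isometry_nrm_minus[OF normed_F Y.normed_vector_space_axioms isometry_\<psi>]
  by blast

lemma nrm_\<phi>_minus:
  assumes "i \<in> I" "j \<in> I" "leq i j" "x \<in> carrier (F i)" "y \<in> carrier (F j)"
  shows "nrm (F j) (\<phi> i j x \<ominus>\<^bsub>F j\<^esub> y) = nrm Y (\<psi> i x \<ominus>\<^bsub>Y\<^esub> \<psi> j y)"
  using assms nrm_\<psi>_minus[of j "\<phi> i j x" y] by (simp add: \<phi>_in \<psi>_\<phi>)

lemma eventually_index: "eventually (\<lambda>i. i \<in> I) (tails I leq)"
  using directed by (auto simp: eventually_tails[OF directed] directed_set_def)

lemma tails_neq_bot: "tails I leq \<noteq> bot"
  using leq_refl by (auto simp: trivial_limit_def eventually_tails[OF directed])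

definition represents :: "('i \<Rightarrow> 'a) \<Rightarrow> 'b \<Rightarrow> bool" where
  "represents x y \<longleftrightarrow> x \<in> (\<Pi>\<^sub>E i\<in>I. carrier (F i)) \<and> Y.nrm_lim (\<lambda>i. \<psi> i (x i)) y (tails I leq)"

lemma represents_in: "represents x y \<Longrightarrow> i \<in> I \<Longrightarrow> x i \<in> carrier (F i)"
  by (auto simp: represents_def)

lemma represented_in: "represents x y \<Longrightarrow> y \<in> carrier Y"
  by (auto simp: represents_def Y.nrm_lim_def)

lemma representsI:
  assumes "x \<in> (\<Pi>\<^sub>E i\<in>I. carrier (F i))" "y \<in> carrier Y"
    and "\<And>e. e > 0 \<Longrightarrow> \<exists>l\<in>I. \<forall>i\<in>I. leq l i \<longrightarrow> nrm Y (\<psi> i (x i) \<ominus>\<^bsub>Y\<^esub> y) < e"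
  shows "represents x y"
  unfolding represents_def Y.nrm_lim_def
proof (intro conjI tendstoI)
  show ev: "eventually (\<lambda>i. \<psi> i (x i) \<in> carrier Y) (tails I leq)"
    using eventually_index by eventually_elim (use assms(1) \<psi>_in in auto)
  show "eventually (\<lambda>i. dist (nrm Y (\<psi> i (x i) \<ominus>\<^bsub>Y\<^esub> y)) 0 < e) (tails I leq)" if "e > 0" for e
    using eventually_tails[OF directed, THEN iffD2, OF assms(3)[OF that]] ev
    by eventually_elim (use assms(2) Y.nrm_nonneg in auto)
qed (use assms in auto)

lemma representsD:
  assumes "represents x y" "e > 0"
  shows "\<exists>l\<in>I. \<forall>i\<in>I. leq l i \<longrightarrow> nrm Y (\<psi> i (x i) \<ominus>\<^bsub>Y\<^esub> y) < e"
proof -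
  have "eventually (\<lambda>i. dist (nrm Y (\<psi> i (x i) \<ominus>\<^bsub>Y\<^esub> y)) 0 < e) (tails I leq)"
    using assms by (auto simp: represents_def Y.nrm_lim_def dest: tendstoD)
  then show ?thesis
    unfolding eventually_tails[OF directed] by force
qed

text \<open>
  A convergent net is Cauchy, and \<open>\<psi> j\<close> carries \<open>\<phi> i j (x i)\<close> and \<open>x j\<close> isometrically to two terms
  of the net.
\<close>

lemma represents_co_Cauchy:
  assumes x: "represents x y"
  shows "x \<in> co_Cauchy I leq F \<phi>"
proof -
  have "\<exists>l\<in>I. \<forall>i\<in>I. \<forall>j\<in>I. leq l i \<and> leq i j \<longrightarrow>
          nrm (F j) (\<phi> i j (x i) \<ominus>\<^bsub>F j\<^esub> x j) < e" if "e > 0" for e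
  proof -
    from representsD[OF x, of "e / 2"] that
    obtain l where l: "l \<in> I" "\<And>i. i \<in> I \<Longrightarrow> leq l i \<Longrightarrow> nrm Y (\<psi> i (x i) \<ominus>\<^bsub>Y\<^esub> y) < e / 2"
      by auto
    have "nrm (F j) (\<phi> i j (x i) \<ominus>\<^bsub>F j\<^esub> x j) < e"
      if ij: "i \<in> I" "j \<in> I" "leq l i" "leq i j" for i j
    proof -
      have in_Y: "\<psi> i (x i) \<in> carrier Y" "\<psi> j (x j) \<in> carrier Y" "y \<in> carrier Y"
        using ij represents_in[OF x] represented_in[OF x] by (auto intro: \<psi>_in)
      have "nrm (F j) (\<phi> i j (x i) \<ominus>\<^bsub>F j\<^esub> x j) = nrm Y (\<psi> i (x i) \<ominus>\<^bsub>Y\<^esub> \<psi> j (x j))"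
        using ij represents_in[OF x] by (simp add: nrm_\<phi>_minus)
      also have "\<dots> \<le> nrm Y (\<psi> i (x i) \<ominus>\<^bsub>Y\<^esub> y) + nrm Y (\<psi> j (x j) \<ominus>\<^bsub>Y\<^esub> y)"
        using Y.nrm_minus_triangle[of "\<psi> i (x i)" y "\<psi> j (x j)"] in_Y
        by (simp add: Y.nrm_minus_commute)
      also have "\<dots> < e"
        using l(2)[of i] l(2)[of j] leq_trans[of l i j] ij l(1) by simp
      finally show ?thesis .
    qed
    then show ?thesis
      using l(1) by blast
  qed
  then show ?thesis
    using x by (auto simp: co_Cauchy_def represents_def)
qed

text \<open>
  Completeness of \<open>Y\<close> speaks of sequences, so the net is sampled at indices \<open>c n\<close> beyond which it
  varies by less than \<open>1 / (n + 1)\<close>. The samples form a Cauchy sequence, and its limit attracts the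
  whole net.
\<close>

lemma co_Cauchy_represents:
  assumes x: "x \<in> co_Cauchy I leq F \<phi>"
  shows "\<exists>y. represents x y"
proof -
  let ?z = "\<lambda>i. \<psi> i (x i)"
  have xE: "x \<in> (\<Pi>\<^sub>E i\<in>I. carrier (F i))"
    using x by (simp add: co_Cauchy_def)
  then have xF: "x i \<in> carrier (F i)" if "i \<in> I" for i
    using that by auto
  then have z_in: "?z i \<in> carrier Y" if "i \<in> I" for i
    using that \<psi>_in by blast
  have "\<exists>l\<in>I. \<forall>i\<in>I. leq l i \<longrightarrow> nrm Y (?z l \<ominus>\<^bsub>Y\<^esub> ?z i) < e" if "e > 0" for e
  proof -
    have "\<forall>\<epsilon>>0. \<exists>l\<in>I. \<forall>i\<in>I. \<forall>j\<in>I. leq l i \<and> leq i j \<longrightarrow>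
          nrm (F j) (\<phi> i j (x i) \<ominus>\<^bsub>F j\<^esub> x j) < \<epsilon>"
      using x by (simp add: co_Cauchy_def)
    from this[THEN spec, THEN mp, OF that]
    obtain l where l: "l \<in> I" "\<forall>i\<in>I. \<forall>j\<in>I. leq l i \<and> leq i j \<longrightarrow>
          nrm (F j) (\<phi> i j (x i) \<ominus>\<^bsub>F j\<^esub> x j) < e"
      by (rule bexE)
    have "nrm Y (?z l \<ominus>\<^bsub>Y\<^esub> ?z i) < e" if i: "i \<in> I" "leq l i" for i
      using l(2)[rule_format, of l i] nrm_\<phi>_minus[of l i "x l" "x i"] l(1) i leq_refl xF by simp
    then show ?thesis
      using l(1) by blast
  qed
  then have "\<forall>n. \<exists>l\<in>I. \<forall>i\<in>I. leq l i \<longrightarrow> nrm Y (?z l \<ominus>\<^bsub>Y\<^esub> ?z i) < inverse (real (Suc n))"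
    by simp
  then obtain c where c_in: "\<And>n. c n \<in> I"
    and c: "\<And>n i. i \<in> I \<Longrightarrow> leq (c n) i \<Longrightarrow> nrm Y (?z (c n) \<ominus>\<^bsub>Y\<^esub> ?z i) < inverse (real (Suc n))"
    by metis
  have near: "nrm Y (?z (c m) \<ominus>\<^bsub>Y\<^esub> ?z (c n)) < inverse (real (Suc m)) + inverse (real (Suc n))"
    for m n
  proof -
    \<comment> \<open>The indices \<open>c m\<close> and \<open>c n\<close> need not be comparable, so the estimate passes through \<open>k\<close>.\<close>
    obtain k where k: "k \<in> I" "leq (c m) k" "leq (c n) k"
      using upper_bound c_in by blast
    have "nrm Y (?z (c m) \<ominus>\<^bsub>Y\<^esub> ?z (c n))
        \<le> nrm Y (?z (c m) \<ominus>\<^bsub>Y\<^esub> ?z k) + nrm Y (?z (c n) \<ominus>\<^bsub>Y\<^esub> ?z k)"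
      using Y.nrm_minus_triangle[of "?z (c m)" "?z k" "?z (c n)"] z_in c_in k
      by (simp add: Y.nrm_minus_commute)
    then show ?thesis
      using c[OF k(1,2)] c[OF k(1,3)] by simp
  qed
  have small: "\<exists>N. \<forall>n\<ge>N. inverse (real (Suc n)) < e" if "e > 0" for e
    using LIMSEQ_inverse_real_of_nat[THEN order_tendstoD(2), OF that]
    by (simp add: eventually_sequentially)
  have "\<exists>y. Y.nrm_lim (\<lambda>n. ?z (c n)) y sequentially"
  proof -
    have "\<exists>N. \<forall>m\<ge>N. \<forall>n\<ge>N. nrm Y (?z (c m) \<ominus>\<^bsub>Y\<^esub> ?z (c n)) < e" if "e > 0" for e
    proof -
      obtain N where "\<And>n. n \<ge> N \<Longrightarrow> inverse (real (Suc n)) < e / 2"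
        using small[of "e / 2"] \<open>e > 0\<close> by auto
      moreover have "nrm Y (?z (c m) \<ominus>\<^bsub>Y\<^esub> ?z (c n)) < e"
        if "inverse (real (Suc m)) < e / 2" "inverse (real (Suc n)) < e / 2" for m n
        using near[of m n] that by linarith
      ultimately show ?thesis
        by blast
    qed
    moreover have "range (\<lambda>n. ?z (c n)) \<subseteq> carrier Y"
      using z_in c_in by auto
    ultimately show ?thesis
      using banach_Y unfolding banach_space_def Y.mcomplete_nrm_dist_iff
      by (elim conjE allE[of _ "\<lambda>n. ?z (c n)"]) blast
  qed
  then obtain y where y: "Y.nrm_lim (\<lambda>n. ?z (c n)) y sequentially" ..
  then have y_in: "y \<in> carrier Y"
    by (simp add: Y.nrm_lim_def)
  have "represents x y"
  proof (rule representsI[OF xE y_in])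
    fix e :: real assume "e > 0"
    then have "eventually (\<lambda>n. nrm Y (?z (c n) \<ominus>\<^bsub>Y\<^esub> y) < e / 2) sequentially"
      using y by (intro order_tendstoD(2)) (auto simp: Y.nrm_lim_def)
    moreover have "eventually (\<lambda>n. inverse (real (Suc n)) < e / 2) sequentially"
      using small[of "e / 2"] \<open>e > 0\<close> by (simp add: eventually_sequentially)
    ultimately have "eventually (\<lambda>n. nrm Y (?z (c n) \<ominus>\<^bsub>Y\<^esub> y) < e / 2 \<and> inverse (real (Suc n)) < e / 2)
        sequentially"
      by (rule eventually_conj)
    then obtain n where n: "nrm Y (?z (c n) \<ominus>\<^bsub>Y\<^esub> y) < e / 2" "inverse (real (Suc n)) < e / 2"
      using eventually_happens' trivial_limit_sequentially by blast
    have "nrm Y (?z i \<ominus>\<^bsub>Y\<^esub> y) < e" if "i \<in> I" "leq (c n) i" for i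
      using Y.nrm_minus_triangle[of "?z i" "?z (c n)" y] c[OF that] n that z_in c_in y_in
      by (simp add: Y.nrm_minus_commute[of "?z i" "?z (c n)"])
    then show "\<exists>l\<in>I. \<forall>i\<in>I. leq l i \<longrightarrow> nrm Y (?z i \<ominus>\<^bsub>Y\<^esub> y) < e"
      using c_in by blast
  qed
  then show ?thesis ..
qed

text \<open>
  Since \<open>\<psi> i\<close> is isometric, \<open>nrm (F i) (x i \<ominus> x' i)\<close> tends to \<open>nrm Y (y \<ominus> y')\<close>, which is zero
  only if \<open>y = y'\<close>.
\<close>

lemma represents_rel_iff:
  assumes "represents x y" "represents x' y'"
  shows "(x, x') \<in> co_Cauchy_rel I leq F \<phi> \<longleftrightarrow> y = y'"
proof -
  have "((\<lambda>i. nrm Y (\<psi> i (x i) \<ominus>\<^bsub>Y\<^esub> \<psi> i (x' i))) \<longlongrightarrow> nrm Y (y \<ominus>\<^bsub>Y\<^esub> y')) (tails I leq)"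
    using assms by (auto simp: represents_def intro!: Y.nrm_lim_nrm Y.nrm_lim_minus)
  moreover have "eventually (\<lambda>i. nrm Y (\<psi> i (x i) \<ominus>\<^bsub>Y\<^esub> \<psi> i (x' i))
      = nrm (F i) (x i \<ominus>\<^bsub>F i\<^esub> x' i)) (tails I leq)"
    using eventually_index
    by eventually_elim (use assms represents_in nrm_\<psi>_minus in blast)
  ultimately have "((\<lambda>i. nrm (F i) (x i \<ominus>\<^bsub>F i\<^esub> x' i)) \<longlongrightarrow> nrm Y (y \<ominus>\<^bsub>Y\<^esub> y')) (tails I leq)"
    by (rule Lim_transform_eventually)
  then have "((\<lambda>i. nrm (F i) (x i \<ominus>\<^bsub>F i\<^esub> x' i)) \<longlongrightarrow> 0) (tails I leq)
      \<longleftrightarrow> nrm Y (y \<ominus>\<^bsub>Y\<^esub> y') = 0"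
    using tendsto_unique[OF tails_neq_bot] by metis
  then show ?thesis
    using assms represents_co_Cauchy represented_in
    by (auto simp: co_Cauchy_rel_def Y.nrm_minus_eq_0_iff)
qed

lemma represents_nrm:
  assumes "represents x y"
  shows "((\<lambda>i. nrm (F i) (x i)) \<longlongrightarrow> nrm Y y) (tails I leq)"
proof (rule Lim_transform_eventually)
  show "((\<lambda>i. nrm Y (\<psi> i (x i))) \<longlongrightarrow> nrm Y y) (tails I leq)"
    using assms by (auto simp: represents_def intro!: Y.nrm_lim_nrm)
  show "eventually (\<lambda>i. nrm Y (\<psi> i (x i)) = nrm (F i) (x i)) (tails I leq)"
    using eventually_index
    by eventually_elim (use assms represents_in linear_isometryD(4)[OF isometry_\<psi>] in blast)
qed

lemma represents_add:
  assumes "represents x y" "represents x' y'"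
  shows "represents (\<lambda>i\<in>I. x i \<oplus>\<^bsub>F i\<^esub> x' i) (y \<oplus>\<^bsub>Y\<^esub> y')"
  unfolding represents_def
proof
  show "(\<lambda>i\<in>I. x i \<oplus>\<^bsub>F i\<^esub> x' i) \<in> (\<Pi>\<^sub>E i\<in>I. carrier (F i))"
  proof (rule restrict_PiE_iff[THEN iffD2], rule ballI)
    fix i assume i: "i \<in> I"
    interpret Fi: normed_vector_space "F i"
      using i by (rule normed_F)
    show "x i \<oplus>\<^bsub>F i\<^esub> x' i \<in> carrier (F i)"
      using assms i represents_in by blast
  qed
  show "Y.nrm_lim (\<lambda>i. \<psi> i ((\<lambda>i\<in>I. x i \<oplus>\<^bsub>F i\<^esub> x' i) i)) (y \<oplus>\<^bsub>Y\<^esub> y') (tails I leq)"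
  proof (rule Y.nrm_lim_cong)
    show "Y.nrm_lim (\<lambda>i. \<psi> i (x i) \<oplus>\<^bsub>Y\<^esub> \<psi> i (x' i)) (y \<oplus>\<^bsub>Y\<^esub> y') (tails I leq)"
      using assms by (auto simp: represents_def intro: Y.nrm_lim_add)
    show "eventually (\<lambda>i. \<psi> i (x i) \<oplus>\<^bsub>Y\<^esub> \<psi> i (x' i) = \<psi> i ((\<lambda>i\<in>I. x i \<oplus>\<^bsub>F i\<^esub> x' i) i))
        (tails I leq)"
      using eventually_index
      by eventually_elim
        (use assms represents_in linear_isometryD(2)[OF isometry_\<psi>] in force)
  qed
qed

lemma represents_smult:
  assumes "represents x y"
  shows "represents (\<lambda>i\<in>I. a \<odot>\<^bsub>F i\<^esub> x i) (a \<odot>\<^bsub>Y\<^esub> y)"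
  unfolding represents_def
proof
  show "(\<lambda>i\<in>I. a \<odot>\<^bsub>F i\<^esub> x i) \<in> (\<Pi>\<^sub>E i\<in>I. carrier (F i))"
  proof (rule restrict_PiE_iff[THEN iffD2], rule ballI)
    fix i assume i: "i \<in> I"
    interpret Fi: normed_vector_space "F i"
      using i by (rule normed_F)
    show "a \<odot>\<^bsub>F i\<^esub> x i \<in> carrier (F i)"
      using assms i represents_in by blast
  qed
  show "Y.nrm_lim (\<lambda>i. \<psi> i ((\<lambda>i\<in>I. a \<odot>\<^bsub>F i\<^esub> x i) i)) (a \<odot>\<^bsub>Y\<^esub> y) (tails I leq)"
  proof (rule Y.nrm_lim_cong)
    show "Y.nrm_lim (\<lambda>i. a \<odot>\<^bsub>Y\<^esub> \<psi> i (x i)) (a \<odot>\<^bsub>Y\<^esub> y) (tails I leq)"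
      using assms by (auto simp: represents_def intro: Y.nrm_lim_smult)
    show "eventually (\<lambda>i. a \<odot>\<^bsub>Y\<^esub> \<psi> i (x i) = \<psi> i ((\<lambda>i\<in>I. a \<odot>\<^bsub>F i\<^esub> x i) i)) (tails I leq)"
      using eventually_index
      by eventually_elim
        (use assms represents_in linear_isometryD(3)[OF isometry_\<psi>] in force)
  qed
qed

text \<open>
  If the distance from \<open>y\<close> to the image of \<open>\<psi> i\<close> is positive, twice that distance leaves room for
  some \<open>x\<close>. If it is zero, \<open>y\<close> must be hit exactly: the image is closed because \<open>F i\<close> is complete
  and \<open>\<psi> i\<close> is isometric.
\<close>

lemma quasi_best_approximation:
  assumes i: "i \<in> I" and y: "y \<in> carrier Y"
  shows "\<exists>x\<in>carrier (F i). \<forall>x'\<in>carrier (F i).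
           nrm Y (\<psi> i x \<ominus>\<^bsub>Y\<^esub> y) \<le> 2 * nrm Y (\<psi> i x' \<ominus>\<^bsub>Y\<^esub> y)"
proof -
  interpret Fi: normed_vector_space "F i"
    using i by (rule normed_F)
  let ?g = "\<lambda>x. nrm Y (\<psi> i x \<ominus>\<^bsub>Y\<^esub> y)"
  define d where "d = (INF x\<in>carrier (F i). ?g x)"
  have g_nonneg: "0 \<le> ?g x" if "x \<in> carrier (F i)" for x
    using that i y \<psi>_in Y.nrm_nonneg by simp
  have bdd: "bdd_below (?g ` carrier (F i))"
    using g_nonneg by (intro bdd_belowI2[of _ 0]) auto
  have ne: "carrier (F i) \<noteq> {}"
    by auto
  have d_le: "d \<le> ?g x" if "x \<in> carrier (F i)" for x
    unfolding d_def using bdd that by (rule cINF_lower)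
  have attained: "\<exists>x\<in>carrier (F i). ?g x < e" if "d < e" for e
    using that cINF_less_iff[OF ne bdd] unfolding d_def by blast
  show ?thesis
  proof (cases "d = 0")
    case False
    moreover have "0 \<le> d"
      unfolding d_def using ne g_nonneg by (rule cINF_greatest)
    ultimately have "d < 2 * d"
      by simp
    then obtain x where "x \<in> carrier (F i)" "?g x < 2 * d"
      using attained by blast
    then show ?thesis
      using d_le by (intro bexI[of _ x]) force+
  next
    case True
    then have "\<forall>n. \<exists>x\<in>carrier (F i). ?g x < inverse (real (Suc n))"
      using attained by simp
    then obtain s where s_in: "\<And>n. s n \<in> carrier (F i)" and s: "\<And>n. ?g (s n) < inverse (real (Suc n))"
      by metis
    have lim_y: "Y.nrm_lim (\<lambda>n. \<psi> i (s n)) y sequentially"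
    proof (rule Y.nrm_limI[OF y _ _ LIMSEQ_inverse_real_of_nat])
      show "\<forall>\<^sub>F n in sequentially. \<psi> i (s n) \<in> carrier Y"
        using i s_in \<psi>_in by simp
      show "\<forall>\<^sub>F n in sequentially. ?g (s n) \<le> inverse (real (Suc n))"
        using s by (simp add: less_imp_le)
    qed
    have "\<exists>N. \<forall>m\<ge>N. \<forall>n\<ge>N. nrm (F i) (s m \<ominus>\<^bsub>F i\<^esub> s n) < e" if "e > 0" for e
    proof -
      have "eventually (\<lambda>n. ?g (s n) < e / 2) sequentially"
        using lim_y that by (intro order_tendstoD(2)) (auto simp: Y.nrm_lim_def)
      then obtain N where N: "\<And>n. n \<ge> N \<Longrightarrow> ?g (s n) < e / 2"
        unfolding eventually_sequentially by blast
      have "nrm (F i) (s m \<ominus>\<^bsub>F i\<^esub> s n) < e" if "m \<ge> N" "n \<ge> N" for m n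
      proof -
        have "nrm (F i) (s m \<ominus>\<^bsub>F i\<^esub> s n) \<le> ?g (s m) + ?g (s n)"
          using Y.nrm_minus_triangle[of "\<psi> i (s m)" y "\<psi> i (s n)"] i s_in y
          by (simp add: nrm_\<psi>_minus \<psi>_in Y.nrm_minus_commute)
        then show ?thesis
          using N[OF that(1)] N[OF that(2)] by simp
      qed
      then show ?thesis
        by blast
    qed
    moreover have "range s \<subseteq> carrier (F i)"
      using s_in by auto
    ultimately obtain x where x: "Fi.nrm_lim s x sequentially"
      using banach_F[OF i] unfolding banach_space_def Fi.mcomplete_nrm_dist_iff by blast
    then have x_in: "x \<in> carrier (F i)"
      by (simp add: Fi.nrm_lim_def)
    have "Y.nrm_lim (\<lambda>n. \<psi> i (s n)) (\<psi> i x) sequentially"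
      using x i s_in x_in by (simp add: Fi.nrm_lim_def Y.nrm_lim_def nrm_\<psi>_minus \<psi>_in)
    then have "\<psi> i x = y"
      using lim_y by (rule Y.nrm_lim_unique) simp
    then have "?g x = 0"
      using y by (simp add: Y.nrm_minus_eq_0_iff)
    then show ?thesis
      using x_in g_nonneg by (intro bexI[of _ x]) auto
  qed
qed

definition union_closure :: "'b set" where
  "union_closure = {y \<in> carrier Y. \<forall>e>0. \<exists>i\<in>I. \<exists>x\<in>carrier (F i). nrm Y (\<psi> i x \<ominus>\<^bsub>Y\<^esub> y) < e}"

text \<open>
  A point of \<open>F l\<close> whose image is close to \<open>y\<close> can be transported to every \<open>i\<close> above \<open>l\<close> without
  moving that image, so the quasi-best approximations beyond \<open>l\<close> are almost as good.
\<close>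

lemma union_closure_represented:
  assumes "y \<in> union_closure"
  shows "\<exists>x. represents x y"
proof -
  have y: "y \<in> carrier Y"
    using assms by (simp add: union_closure_def)
  have "\<forall>i\<in>I. \<exists>x\<in>carrier (F i). \<forall>x'\<in>carrier (F i).
          nrm Y (\<psi> i x \<ominus>\<^bsub>Y\<^esub> y) \<le> 2 * nrm Y (\<psi> i x' \<ominus>\<^bsub>Y\<^esub> y)"
    using quasi_best_approximation y by blast
  then obtain f where f_in: "\<And>i. i \<in> I \<Longrightarrow> f i \<in> carrier (F i)"
    and f: "\<And>i x'. \<lbrakk>i \<in> I; x' \<in> carrier (F i)\<rbrakk> \<Longrightarrow>
               nrm Y (\<psi> i (f i) \<ominus>\<^bsub>Y\<^esub> y) \<le> 2 * nrm Y (\<psi> i x' \<ominus>\<^bsub>Y\<^esub> y)"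
    by metis
  have "represents (restrict f I) y"
  proof (rule representsI[OF _ y])
    show "restrict f I \<in> (\<Pi>\<^sub>E i\<in>I. carrier (F i))"
      using f_in by auto
    fix e :: real assume "e > 0"
    then have "e / 2 > 0"
      by simp
    then obtain l x' where l: "l \<in> I" "x' \<in> carrier (F l)" "nrm Y (\<psi> l x' \<ominus>\<^bsub>Y\<^esub> y) < e / 2"
      using assms unfolding union_closure_def by blast
    have "nrm Y (\<psi> i (restrict f I i) \<ominus>\<^bsub>Y\<^esub> y) < e" if i: "i \<in> I" "leq l i" for i
    proof -
      have "nrm Y (\<psi> i (f i) \<ominus>\<^bsub>Y\<^esub> y) \<le> 2 * nrm Y (\<psi> i (\<phi> l i x') \<ominus>\<^bsub>Y\<^esub> y)"
        using i l by (intro f \<phi>_in)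
      also have "\<dots> < e"
        using i l by (simp add: \<psi>_\<phi>)
      finally show ?thesis
        using i by simp
    qed
    then show "\<exists>l\<in>I. \<forall>i\<in>I. leq l i \<longrightarrow> nrm Y (\<psi> i (restrict f I i) \<ominus>\<^bsub>Y\<^esub> y) < e"
      using l(1) by blast
  qed
  then show ?thesis
    by blast
qed

lemma represents_union_closure:
  assumes "represents x y"
  shows "y \<in> union_closure"
proof -
  have "\<exists>i\<in>I. \<exists>x\<in>carrier (F i). nrm Y (\<psi> i x \<ominus>\<^bsub>Y\<^esub> y) < e" if "e > 0" for e
    using representsD[OF assms that] leq_refl represents_in[OF assms] by blast
  then show ?thesis
    using represented_in[OF assms] by (simp add: union_closure_def)
qed

lemma \<psi>_in_union_closure:
  assumes "i \<in> I" "x \<in> carrier (F i)"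
  shows "\<psi> i x \<in> union_closure"
proof -
  have "nrm Y (\<psi> i x \<ominus>\<^bsub>Y\<^esub> \<psi> i x) = 0"
    using assms \<psi>_in by (simp add: Y.nrm_minus_eq_0_iff)
  then show ?thesis
    using assms \<psi>_in by (auto simp: union_closure_def intro!: bexI[of _ i] bexI[of _ x])
qed

text \<open>
  Closure under the linear operations is read off from limits of families: their pointwise sums and
  multiples represent the sums and multiples of their limits.
\<close>

lemma cocone_union_closure: "cocone I leq F \<phi> (Y\<lparr>carrier := union_closure\<rparr>) \<psi>"
proof -
  have smult: "a \<odot>\<^bsub>Y\<^esub> y \<in> union_closure" if "y \<in> union_closure" for a y
    using that union_closure_represented represents_smult represents_union_closure by meson
  have "banach_space (Y\<lparr>carrier := union_closure\<rparr>)"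
  proof (rule Y.banach_space_closed_subspace[OF banach_Y])
    show sub: "union_closure \<subseteq> carrier Y"
      by (auto simp: union_closure_def)
    obtain i where i: "i \<in> I"
      using directed by (auto simp: directed_set_def)
    interpret Fi: normed_vector_space "F i"
      using i by (rule normed_F)
    have "0 \<odot>\<^bsub>Y\<^esub> \<psi> i \<zero>\<^bsub>F i\<^esub> \<in> union_closure"
      using i by (intro smult \<psi>_in_union_closure) auto
    then show "\<zero>\<^bsub>Y\<^esub> \<in> union_closure"
      using i by (simp add: Y.smult_zero_left \<psi>_in)
    show "y \<oplus>\<^bsub>Y\<^esub> y' \<in> union_closure" if "y \<in> union_closure" "y' \<in> union_closure" for y y'
      using that union_closure_represented represents_add represents_union_closure by meson
    show "l \<in> union_closure"
      if s: "range s \<subseteq> union_closure" and l: "Y.nrm_lim s l sequentially" for s l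
    proof -
      have l_in: "l \<in> carrier Y"
        using l by (simp add: Y.nrm_lim_def)
      have "\<exists>i\<in>I. \<exists>x\<in>carrier (F i). nrm Y (\<psi> i x \<ominus>\<^bsub>Y\<^esub> l) < e" if e: "e > 0" for e
      proof -
        have "eventually (\<lambda>n. nrm Y (s n \<ominus>\<^bsub>Y\<^esub> l) < e / 2) sequentially"
          using l e by (intro order_tendstoD(2)) (auto simp: Y.nrm_lim_def)
        then obtain n where n: "nrm Y (s n \<ominus>\<^bsub>Y\<^esub> l) < e / 2"
          using eventually_happens' trivial_limit_sequentially by blast
        have sn: "s n \<in> union_closure" "e / 2 > 0"
          using s e by auto
        then obtain i x where x: "i \<in> I" "x \<in> carrier (F i)" "nrm Y (\<psi> i x \<ominus>\<^bsub>Y\<^esub> s n) < e / 2"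
          unfolding union_closure_def by blast
        have "nrm Y (\<psi> i x \<ominus>\<^bsub>Y\<^esub> l) < e"
          using Y.nrm_minus_triangle[of "\<psi> i x" "s n" l] x n \<psi>_in[of i x] sn l_in sub by auto
        then show ?thesis
          using x by blast
      qed
      then show ?thesis
        using l_in by (simp add: union_closure_def)
    qed
  qed (rule smult)
  moreover have "linear_isometry (F i) (Y\<lparr>carrier := union_closure\<rparr>) (\<psi> i)" if "i \<in> I" for i
    using linear_isometryD[OF isometry_\<psi>[OF that]] \<psi>_in_union_closure[OF that]
    by (auto simp: linear_isometry_def)
  ultimately show ?thesis
    using \<psi>_\<phi> by (simp add: cocone_def)
qed

definition representing_class :: "'b \<Rightarrow> ('i \<Rightarrow> 'a) set" where
  "representing_class y = {x. represents x y}"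

lemma co_Cauchy_rel_Image:
  assumes "represents x y"
  shows "co_Cauchy_rel I leq F \<phi> `` {x} = representing_class y"
proof -
  have "(x, x') \<in> co_Cauchy_rel I leq F \<phi> \<longleftrightarrow> represents x' y" for x'
  proof
    assume xx': "(x, x') \<in> co_Cauchy_rel I leq F \<phi>"
    then obtain y' where "represents x' y'"
      using co_Cauchy_represents by (auto simp: co_Cauchy_rel_def)
    then show "represents x' y"
      using xx' represents_rel_iff[OF assms] by blast
  next
    assume "represents x' y"
    then show "(x, x') \<in> co_Cauchy_rel I leq F \<phi>"
      using represents_rel_iff[OF assms] by blast
  qed
  then show ?thesis
    by (auto simp: representing_class_def)
qed

lemma isometrically_isomorphic_co_Cauchy_space:
  assumes dense: "union_closure = carrier Y"
  shows "isometrically_isomorphic Y (co_Cauchy_space I leq F \<phi>)"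
proof -
  let ?L = "co_Cauchy_space I leq F \<phi>" and ?R = "co_Cauchy_rel I leq F \<phi>"
  have rep: "\<exists>x. represents x y" if "y \<in> carrier Y" for y
    using that dense union_closure_represented by blast
  have carrier_L: "carrier ?L = co_Cauchy I leq F \<phi> // ?R"
    by (simp add: co_Cauchy_space_def Let_def)
  have in_L: "representing_class y \<in> carrier ?L" if "y \<in> carrier Y" for y
    using rep[OF that] represents_co_Cauchy co_Cauchy_rel_Image
    unfolding carrier_L by (metis quotientI)
  have add: "representing_class (y \<oplus>\<^bsub>Y\<^esub> y') = representing_class y \<oplus>\<^bsub>?L\<^esub> representing_class y'"
    if y: "y \<in> carrier Y" "y' \<in> carrier Y" for y y'
  proof -
    have "?R `` {\<lambda>i\<in>I. x i \<oplus>\<^bsub>F i\<^esub> x' i} = representing_class (y \<oplus>\<^bsub>Y\<^esub> y')"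
      if "x \<in> representing_class y" "x' \<in> representing_class y'" for x x'
      using that by (intro co_Cauchy_rel_Image represents_add) (auto simp: representing_class_def)
    moreover have "representing_class y \<noteq> {}" "representing_class y' \<noteq> {}"
      using rep y by (auto simp: representing_class_def)
    ultimately show ?thesis
      by (simp add: co_Cauchy_space_def Let_def)
  qed
  have smult: "representing_class (a \<odot>\<^bsub>Y\<^esub> y) = a \<odot>\<^bsub>?L\<^esub> representing_class y"
    if y: "y \<in> carrier Y" for a y
  proof -
    have "?R `` {\<lambda>i\<in>I. a \<odot>\<^bsub>F i\<^esub> x i} = representing_class (a \<odot>\<^bsub>Y\<^esub> y)"
      if "x \<in> representing_class y" for x
      using that by (intro co_Cauchy_rel_Image represents_smult) (auto simp: representing_class_def)
    moreover have "representing_class y \<noteq> {}"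
      using rep y by (auto simp: representing_class_def)
    ultimately show ?thesis
      by (simp add: co_Cauchy_space_def Let_def)
  qed
  have nrm: "nrm ?L (representing_class y) = nrm Y y" if y: "y \<in> carrier Y" for y
  proof -
    have "(THE r. \<forall>x\<in>representing_class y. ((\<lambda>i. nrm (F i) (x i)) \<longlongrightarrow> r) (tails I leq)) = nrm Y y"
    proof (rule the_equality)
      show "\<forall>x\<in>representing_class y. ((\<lambda>i. nrm (F i) (x i)) \<longlongrightarrow> nrm Y y) (tails I leq)"
        using represents_nrm by (auto simp: representing_class_def)
      show "r = nrm Y y"
        if "\<forall>x\<in>representing_class y. ((\<lambda>i. nrm (F i) (x i)) \<longlongrightarrow> r) (tails I leq)" for r
      proof -
        obtain x where x: "represents x y"
          using rep[OF y] ..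
        then have "((\<lambda>i. nrm (F i) (x i)) \<longlongrightarrow> r) (tails I leq)"
          using that by (simp add: representing_class_def)
        then show ?thesis
          using represents_nrm[OF x] by (rule tendsto_unique[OF tails_neq_bot])
      qed
    qed
    then show ?thesis
      by (simp add: co_Cauchy_space_def Let_def)
  qed
  have "linear_isometry Y ?L representing_class"
    using in_L add smult nrm by (auto simp: linear_isometry_def)
  moreover have "bij_betw representing_class (carrier Y) (carrier ?L)"
    unfolding bij_betw_def
  proof
    show "inj_on representing_class (carrier Y)"
    proof (rule inj_onI)
      fix y y' assume y: "y \<in> carrier Y" and eq: "representing_class y = representing_class y'"
      obtain x where "represents x y"
        using rep[OF y] ..
      moreover from this eq have "represents x y'"
        by (auto simp: representing_class_def)
      ultimately show "y = y'"
        using tails_neq_bot by (auto simp: represents_def intro: Y.nrm_lim_unique)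
    qed
    have "A \<in> representing_class ` carrier Y" if "A \<in> carrier ?L" for A
    proof -
      obtain x where x: "x \<in> co_Cauchy I leq F \<phi>" "A = ?R `` {x}"
        using \<open>A \<in> carrier ?L\<close> unfolding carrier_L by (rule quotientE)
      then show ?thesis
        using co_Cauchy_represents co_Cauchy_rel_Image represented_in by blast
    qed
    then show "representing_class ` carrier Y = carrier ?L"
      using in_L by blast
  qed
  ultimately show ?thesis
    unfolding isometrically_isomorphic_def by blast
qed

end


section \<open>The colimit\<close>

text \<open>
  Composing the map from \<open>Y\<close> to the closure, given by the universal property, with the inclusion
  yields an endomorphism of \<open>Y\<close> that fixes the cocone, hence the identity; so \<open>Y\<close> lies in the
  closure.
\<close>

lemma colimit_union_dense:
  fixes F :: "'i \<Rightarrow> ('k :: real_normed_field, 'a) normed_module"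
    and Y :: "('k, 'b) normed_module"
  assumes "directed_set I leq" "codiagram I leq F \<phi>" and colim: "is_colimit I leq F \<phi> Y \<psi>"
  shows "directed_cocone.union_closure I F Y \<psi> = carrier Y"
proof -
  have coc: "cocone I leq F \<phi> Y \<psi>"
    using colim by (simp add: is_colimit_def)
  interpret directed_cocone I leq F \<phi> Y \<psi>
    using assms coc by unfold_locales
  let ?D = "Y\<lparr>carrier := union_closure\<rparr>"
  have sub: "union_closure \<subseteq> carrier Y"
    by (auto simp: union_closure_def)
  have univ: "\<exists>!f. f \<in> extensional (carrier Y) \<and> linear_isometry Y Z f \<and>
      (\<forall>i\<in>I. \<forall>x\<in>carrier (F i). f (\<psi> i x) = \<psi> i x)"
    if "cocone I leq F \<phi> Z \<psi>" for Z :: "('k, 'b) normed_module"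
    using colim that unfolding is_colimit_def by blast
  obtain f where f: "f \<in> extensional (carrier Y)" "linear_isometry Y ?D f"
      "\<forall>i\<in>I. \<forall>x\<in>carrier (F i). f (\<psi> i x) = \<psi> i x"
    using univ[OF cocone_union_closure] by blast
  have "linear_isometry Y Y f"
    using f(2) sub by (auto simp: linear_isometry_def)
  moreover have "linear_isometry Y Y (restrict id (carrier Y))"
    by (auto simp: linear_isometry_def)
  ultimately have "f = restrict id (carrier Y)"
    using univ[OF coc] f \<psi>_in by (metis (no_types, lifting) id_apply restrict_apply' restrict_extensional)
  then have "y \<in> union_closure" if "y \<in> carrier Y" for y
    using linear_isometryD(1)[OF f(2) that] that by simp
  then show ?thesis
    using sub by blast
qed

theorem theoremA1:
  fixes I :: "'i set" and leq :: "'i \<Rightarrow> 'i \<Rightarrow> bool"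
    and F :: "'i \<Rightarrow> ('k :: real_normed_field, 'a) normed_module"
    and \<phi> :: "'i \<Rightarrow> 'i \<Rightarrow> 'a \<Rightarrow> 'a"
    and Y :: "('k, 'b) normed_module"
    and \<psi> :: "'i \<Rightarrow> 'a \<Rightarrow> 'b"
  assumes "directed_set I leq"
    and "E_property I leq"
    and "codiagram I leq F \<phi>"
    and "is_colimit I leq F \<phi> Y \<psi>"
  shows "isometrically_isomorphic Y (co_Cauchy_space I leq F \<phi>)"
proof -
  have "cocone I leq F \<phi> Y \<psi>"
    using assms(4) by (simp add: is_colimit_def)
  then interpret directed_cocone I leq F \<phi> Y \<psi>
    using assms(1,3) by unfold_locales
  show ?thesis
    using assms(1,3,4) by (intro isometrically_isomorphic_co_Cauchy_space colimit_union_dense)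
qed

end
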